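(* Let $k,t,r$ be integers with $t>r>2$, $k=\binom{t-1}{r-1}$ and $kr\geq 2t$. Let $n,l$ be integers with $n=l+pt$ for some integer $p\geq 0$ and $l\geq 2t+2$, and put $a=\lceil l/2\rceil$, $b=\lfloor l/2\rfloor$. Let $H_0$ be the $r$-uniform hypergraph obtained from vertex-disjoint copies $A\cong K_a^r$ and $B\cong K_b^r$ by adding $k$ distinct new edges, each an $r$-subset of $V(A)\cup V(B)$ meeting both $V(A)$ and $V(B)$. Let $H$ be obtained from $H_0$ by adding $p$ vertex-disjoint copies $S_1,\dots,S_p$ of $K_t^r$ (disjoint from $H_0$) and, for each $j$, $k$ distinct new edges, each an $r$-subset of $V(S_j)\cup V(H_0)$ meeting both $V(S_j)$ and $V(H_0)$, such that (i) every vertex of $S_j$ lies in at least one of these $k$ edges, and (ii) at least one of these $k$ edges meets $V(A)$ and at least one of them meets $V(B)$. Then $H$ is a $(k,l)$-edge-maximal $r$-uniform hypergraph.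
   Context: A hypergraph $H=(V,E)$ has a finite vertex set $V$ and a set $E$ of nonempty subsets of $V$ (edges); it is $r$-uniform if every edge has exactly $r$ elements. $K_m^r$ denotes the complete $r$-uniform hypergraph on $m$ vertices. A subhypergraph $H'=(V',E')$ of $H$ has $V'\subseteq V$, $E'\subseteq E$ (with each edge of $E'$ contained in $V'$). For $X\subseteq V$, $d_H(X)$ is the number of edges meeting both $X$ and $V\setminus X$; $\kappa'(H)=\min\{d_H(X):\emptyset\neq X\subsetneq V\}$. For an $r$-subset $e\notin E$ of $V$, $H+e=(V,E\cup\{e\})$. An $r$-uniform hypergraph $H$ is $(k,l)$-edge-maximal if every subhypergraph $H'$ with $|V(H')|\geq l$ has $\kappa'(H')\leq k$, but for every $r$-subset $e$ of $V(H)$ not in $E(H)$, $H+e$ has a subhypergraph $H''$ with $|V(H'')|\geq l$ and $\kappa'(H'')\geq k+1$. *)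

theory Defs
  imports Complex_Main "HOL-Library.Disjoint_Sets"
begin

datatype 'a hypergraph = Hypergraph (verts: "'a set") (edges: "'a set set")

definition hypergraph :: "'a hypergraph \<Rightarrow> bool" where
  "hypergraph H \<longleftrightarrow> finite (verts H) \<and> (\<forall>e\<in>edges H. e \<noteq> {} \<and> e \<subseteq> verts H)"

definition uniform_hypergraph :: "nat \<Rightarrow> 'a hypergraph \<Rightarrow> bool" where
  "uniform_hypergraph r H \<longleftrightarrow> hypergraph H \<and> (\<forall>e\<in>edges H. card e = r)"

(* A copy of K_m^r, not necessarily the standard one: any m-element vertex set is allowed. *)
definition is_complete :: "nat \<Rightarrow> nat \<Rightarrow> 'a hypergraph \<Rightarrow> bool" where
  "is_complete r m H \<longleftrightarrow>
     finite (verts H) \<and> card (verts H) = m \<and> edges H = {e. e \<subseteq> verts H \<and> card e = r}"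

definition subhypergraph :: "'a hypergraph \<Rightarrow> 'a hypergraph \<Rightarrow> bool" where
  "subhypergraph H' H \<longleftrightarrow>
     verts H' \<subseteq> verts H \<and> edges H' \<subseteq> edges H \<and> (\<forall>e\<in>edges H'. e \<subseteq> verts H')"

definition cut_degree :: "'a hypergraph \<Rightarrow> 'a set \<Rightarrow> nat" where
  "cut_degree H X = card {e \<in> edges H. e \<inter> X \<noteq> {} \<and> e \<inter> (verts H - X) \<noteq> {}}"

(* For fewer than two vertices this is the minimum of the empty set, an unspecified number. *)
definition edge_connectivity :: "'a hypergraph \<Rightarrow> nat" where
  "edge_connectivity H = Min {cut_degree H X | X. X \<noteq> {} \<and> X \<subset> verts H}"

definition add_edge :: "'a hypergraph \<Rightarrow> 'a set \<Rightarrow> 'a hypergraph" where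
  "add_edge H e = Hypergraph (verts H) (insert e (edges H))"

definition edge_maximal :: "nat \<Rightarrow> nat \<Rightarrow> nat \<Rightarrow> 'a hypergraph \<Rightarrow> bool" where
  "edge_maximal r k l H \<longleftrightarrow>
     uniform_hypergraph r H \<and>
     (\<forall>H'. subhypergraph H' H \<and> card (verts H') \<ge> l \<longrightarrow> edge_connectivity H' \<le> k) \<and>
     (\<forall>e. e \<subseteq> verts H \<and> card e = r \<and> e \<notin> edges H \<longrightarrow>
        (\<exists>H''. subhypergraph H'' (add_edge H e) \<and> card (verts H'') \<ge> l \<and>
               edge_connectivity H'' \<ge> k + 1))"

definition crossing_sets :: "nat \<Rightarrow> 'a set \<Rightarrow> 'a set \<Rightarrow> 'a set set" where
  "crossing_sets r X Y = {e. e \<subseteq> X \<union> Y \<and> card e = r \<and> e \<inter> X \<noteq> {} \<and> e \<inter> Y \<noteq> {}}"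

end

theory Submission
  imports Defs
begin

text \<open>
  A proper cut of a complete \<open>r\<close>-uniform hypergraph on \<open>m\<close> vertices has at least
  \<open>(m - 1) choose (r - 1)\<close> edges.  For a subhypergraph of \<open>H\<close> with at least \<open>l\<close> vertices, cutting
  off its part in some \<open>S j\<close>, or else \<open>A\<close> from \<open>B\<close>, costs at most \<open>k\<close> edges.  For a non-edge \<open>e\<close>,
  take \<open>H0\<close>, the new edge, and all \<open>S j\<close> that meet \<open>e\<close>, with their edges \<open>G j\<close>.  A cut
  splitting \<open>A\<close> or \<open>B\<close> has at least \<open>t choose (r - 1) > k\<close> edges.  If it separates \<open>A\<close> from \<open>B\<close>, it
  contains \<open>F\<close> and, in addition, an edge at some \<open>S j\<close>, or \<open>e\<close> if there is no such \<open>j\<close>.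
  If it leaves \<open>A \<union> B\<close> on one side, it either splits some \<open>S j\<close>, and then contains \<open>k\<close> edges of \<open>S j\<close>
  and an edge of \<open>G j\<close>, or it contains \<open>G j\<close> for some \<open>j\<close> and a further edge, which is \<open>e\<close> if
  the cut isolates \<open>S j\<close> alone.
\<close>

section \<open>Cuts as sets of edges, and bounds on edge connectivity\<close>

definition cut_edges :: "'a hypergraph \<Rightarrow> 'a set \<Rightarrow> 'a set set" where
  "cut_edges H X = {e \<in> edges H. e \<inter> X \<noteq> {} \<and> e \<inter> (verts H - X) \<noteq> {}}"

lemma cut_degree_eq_card_cut_edges: "cut_degree H X = card (cut_edges H X)"
  by (simp add: cut_degree_def cut_edges_def)

lemma cut_edges_subset: "cut_edges H X \<subseteq> edges H"
  by (auto simp: cut_edges_def)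

lemma finite_edges:
  assumes "hypergraph H"
  shows "finite (edges H)"
proof (rule finite_subset)
  show "edges H \<subseteq> Pow (verts H)" using assms by (auto simp: hypergraph_def)
  show "finite (Pow (verts H))" using assms by (simp add: hypergraph_def)
qed

lemma finite_cut_edges: "hypergraph H \<Longrightarrow> finite (cut_edges H X)"
  by (rule finite_subset[OF cut_edges_subset finite_edges])

lemma cut_degree_complement:
  assumes "X \<subseteq> verts H"
  shows "cut_degree H (verts H - X) = cut_degree H X"
proof -
  have "verts H - (verts H - X) = X" using assms by blast
  then show ?thesis unfolding cut_degree_def by (simp add: conj_commute)
qed

text \<open>Below, every bound \<open>k + 1\<close> not coming from a split of \<open>A\<close> or
  \<open>B\<close> arises this way: \<open>P\<close> supplies \<open>k\<close> cut edges of one kind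
  and \<open>e\<close> is one of another kind.\<close>

lemma cut_degree_ge_Suc:
  assumes "hypergraph H" "P \<subseteq> cut_edges H X" "e \<in> cut_edges H X" "e \<notin> P" "k \<le> card P"
  shows "k + 1 \<le> cut_degree H X"
proof -
  have fin: "finite (cut_edges H X)" using assms(1) by (rule finite_cut_edges)
  then have "finite P" using assms(2) by (rule finite_subset[rotated])
  then have "Suc (card P) = card (insert e P)" using assms(4) by simp
  also have "\<dots> \<le> card (cut_edges H X)" using fin assms(2,3) by (intro card_mono) auto
  finally show ?thesis using assms(5) by (simp add: cut_degree_eq_card_cut_edges)
qed

lemma finite_cut_degrees:
  assumes "finite (verts H)"
  shows "finite {cut_degree H X | X. X \<noteq> {} \<and> X \<subset> verts H}"
proof (rule finite_subset)
  show "{cut_degree H X | X. X \<noteq> {} \<and> X \<subset> verts H} \<subseteq> cut_degree H ` Pow (verts H)" by auto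
qed (use assms in simp)

lemma edge_connectivity_le:
  assumes "finite (verts H)" "X \<noteq> {}" "X \<subset> verts H"
  shows "edge_connectivity H \<le> cut_degree H X"
  unfolding edge_connectivity_def
  using assms by (intro Min_le finite_cut_degrees) auto

text \<open>With two vertices a singleton is a proper cut, so the set under \<open>Min\<close> is
  nonempty and its minimum is meaningful.\<close>

lemma edge_connectivity_ge:
  assumes "finite (verts H)" "2 \<le> card (verts H)"
    and "\<And>X. X \<noteq> {} \<Longrightarrow> X \<subset> verts H \<Longrightarrow> c \<le> cut_degree H X"
  shows "c \<le> edge_connectivity H"
proof -
  obtain v where v: "v \<in> verts H" using assms(2) by fastforce
  have "verts H \<noteq> {v}" using assms(2) by auto
  then have "{v} \<subset> verts H" using v by blast
  then have "{cut_degree H X | X. X \<noteq> {} \<and> X \<subset> verts H} \<noteq> {}" by blast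
  then show ?thesis
    unfolding edge_connectivity_def using assms(3)
    by (intro Min.boundedI finite_cut_degrees assms(1)) auto
qed

section \<open>Cuts of complete hypergraphs\<close>

text \<open>For \<open>y\<close> in \<open>Y\<close>, the subsets of \<open>V - {y}\<close> of size
  \<open>r - 1\<close> inject into the crossing sets. A singleton \<open>Y\<close> attains the
  bound.\<close>

lemma binomial_le_card_cut:
  fixes V Y :: "'a set"
  assumes fin: "finite V" and Y: "Y \<noteq> {}" "Y \<subset> V" and r: "2 \<le> r"
  shows "(card V - 1) choose (r - 1)
    \<le> card {e. e \<subseteq> V \<and> card e = r \<and> e \<inter> Y \<noteq> {} \<and> e \<inter> (V - Y) \<noteq> {}}"
proof -
  obtain y z where y: "y \<in> Y" and z: "z \<in> V" "z \<notin> Y" using Y by blast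
  define D where "D = {d. d \<subseteq> V - {y} \<and> card d = r - 1}"
  define C where "C = {e. e \<subseteq> V \<and> card e = r \<and> e \<inter> Y \<noteq> {} \<and> e \<inter> (V - Y) \<noteq> {}}"
  \<comment> \<open>Completing \<open>d \<subseteq> Y\<close> by \<open>z\<close> and any other \<open>d\<close> by \<open>y\<close> makes the completed set cross the cut.\<close>
  define f where "f d = insert (if d \<subseteq> Y then z else y) d" for d
  have finD: "finite d" if "d \<in> D" for d
    using that fin by (auto simp: D_def intro: finite_subset)
  have "inj_on f D"
  proof (rule inj_onI)
    fix c d assume c: "c \<in> D" and d: "d \<in> D" and eq: "f c = f d"
    have "y \<notin> c" "y \<notin> d" using c d by (auto simp: D_def)
    moreover have "y \<noteq> z" using y z by blast
    \<comment> \<open>The branch taken by \<open>f\<close> can be read off its value: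
      \<open>y\<close> belongs to \<open>f d\<close> exactly when \<open>d\<close> is not inside
      \<open>Y\<close>. Within a branch the added point is not in the set, so deleting it recovers
      the set.\<close>
    ultimately have "c \<subseteq> Y \<longleftrightarrow> d \<subseteq> Y" using eq by (auto simp: f_def split: if_splits)
    then show "c = d"
      using eq \<open>y \<notin> c\<close> \<open>y \<notin> d\<close> z by (auto simp: f_def split: if_splits)
  qed
  moreover have "f ` D \<subseteq> C"
  proof (rule image_subsetI)
    fix d assume d: "d \<in> D"
    \<comment> \<open>If \<open>d\<close> lies inside \<open>Y\<close>, the added point is
      \<open>z\<close>, so the point of \<open>f d\<close> in \<open>Y\<close> must come from
      \<open>d\<close> itself; this is where \<open>r \<ge> 2\<close> enters.\<close>
    have "d \<noteq> {}" using d r by (auto simp: D_def)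
    moreover have "d \<subseteq> V" "y \<notin> d" "card d = r - 1" using d by (auto simp: D_def)
    ultimately show "f d \<in> C"
      using finD[OF d] y z Y r by (auto simp: C_def f_def card_insert_if)
  qed
  moreover have "finite C"
    by (rule finite_subset[of _ "Pow V"]) (auto simp: C_def fin)
  ultimately have "card D \<le> card C" by (metis card_image card_mono)
  moreover have "card D = (card V - 1) choose (r - 1)"
    using n_subsets[of "V - {y}" "r - 1"] fin y Y by (auto simp: D_def)
  ultimately show ?thesis by (simp add: C_def)
qed

text \<open>\<open>X\<close> induces a proper cut of \<open>K\<close>, and each edge of
  \<open>K\<close> crossing it also crosses \<open>X\<close> in \<open>H\<close>. The count stays
  inside \<open>edges K\<close> so that an edge outside \<open>K\<close> can be added on
  top.\<close>

lemma complete_card_cut_edges_ge: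
  assumes "hypergraph H" "is_complete r m K" "verts K \<subseteq> verts H" "edges K \<subseteq> edges H"
    and "X \<inter> verts K \<noteq> {}" "\<not> verts K \<subseteq> X" "2 \<le> r"
  shows "(m - 1) choose (r - 1) \<le> card (cut_edges H X \<inter> edges K)"
proof -
  let ?V = "verts K" and ?Y = "X \<inter> verts K"
  let ?C = "{e. e \<subseteq> ?V \<and> card e = r \<and> e \<inter> ?Y \<noteq> {} \<and> e \<inter> (?V - ?Y) \<noteq> {}}"
  have "?C \<subseteq> cut_edges H X \<inter> edges K"
    using assms(2-4) by (auto simp: cut_edges_def is_complete_def)
  then have "card ?C \<le> card (cut_edges H X \<inter> edges K)"
    using finite_cut_edges[OF assms(1)] by (intro card_mono) auto
  moreover have "(card ?V - 1) choose (r - 1) \<le> card ?C"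
    using assms by (intro binomial_le_card_cut) (auto simp: is_complete_def)
  ultimately show ?thesis using assms(2) by (simp add: is_complete_def)
qed

section \<open>Connectivity after adding a non-edge\<close>

text \<open>In the application \<open>J\<close> indexes the copies \<open>S j\<close> that meet the
  added edge \<open>e\<close>. The conditions \<open>e_S\<close> and \<open>e_AB\<close> express
  what this choice of \<open>J\<close>, together with \<open>e\<close> being a non-edge, says about
  the position of \<open>e\<close>.\<close>

lemma edge_connectivity_attached_ge:
  fixes A B :: "'a hypergraph" and S :: "'i \<Rightarrow> 'a hypergraph" and G :: "'i \<Rightarrow> 'a set set"
  assumes tr: "t > r" "r \<ge> 2" and k: "k = (t - 1) choose (r - 1)"
    and ab: "t < a" "t < b"
    and A: "is_complete r a A" and B: "is_complete r b B"
    and AB: "verts A \<inter> verts B = {}"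
    and F: "card F = k" "F \<subseteq> crossing_sets r (verts A) (verts B)"
    and J: "finite J"
    and S: "\<And>j. j \<in> J \<Longrightarrow> is_complete r t (S j)"
    and S_disj: "\<And>i j. i \<in> J \<Longrightarrow> j \<in> J \<Longrightarrow> i \<noteq> j \<Longrightarrow> verts (S i) \<inter> verts (S j) = {}"
    and S_AB: "\<And>j. j \<in> J \<Longrightarrow> verts (S j) \<inter> (verts A \<union> verts B) = {}"
    and G_card: "\<And>j. j \<in> J \<Longrightarrow> card (G j) = k"
    and G: "\<And>j. j \<in> J \<Longrightarrow> G j \<subseteq> crossing_sets r (verts (S j)) (verts A \<union> verts B)"
    and G_cover: "\<And>j v. j \<in> J \<Longrightarrow> v \<in> verts (S j) \<Longrightarrow> \<exists>e\<in>G j. v \<in> e"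
    and G_A: "\<And>j. j \<in> J \<Longrightarrow> \<exists>e\<in>G j. e \<inter> verts A \<noteq> {}"
    and G_B: "\<And>j. j \<in> J \<Longrightarrow> \<exists>e\<in>G j. e \<inter> verts B \<noteq> {}"
    and W: "verts W = verts A \<union> verts B \<union> (\<Union>j\<in>J. verts (S j))"
    and E: "edges W = insert e (edges A \<union> edges B \<union> F \<union> (\<Union>j\<in>J. edges (S j) \<union> G j))"
    and e: "e \<subseteq> verts W" "e \<notin> F" "\<And>j. j \<in> J \<Longrightarrow> e \<notin> G j"
    and e_S: "\<And>j. j \<in> J \<Longrightarrow> e \<inter> verts (S j) \<noteq> {} \<and> \<not> e \<subseteq> verts (S j)"
    and e_AB: "J = {} \<Longrightarrow> e \<inter> verts A \<noteq> {} \<and> e \<inter> verts B \<noteq> {}"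
  shows "k + 1 \<le> edge_connectivity W"
proof -
  have finA: "finite (verts A)" and finB: "finite (verts B)"
    and cA: "card (verts A) = a" and cB: "card (verts B) = b"
    using A B by (auto simp: is_complete_def)
  have finW: "finite (verts W)"
    using finA finB S J by (auto simp: W is_complete_def)
  have "card (verts A) \<le> card (verts W)"
    using finW by (intro card_mono) (auto simp: W)
  then have card_W: "2 \<le> card (verts W)" using cA ab tr by linarith
  have k_pos: "0 < k" using tr by (simp add: k)
  \<comment> \<open>By Pascal's rule the difference is \<open>(t - 1) choose (r - 2)\<close>, which
    is positive because \<open>r - 2 \<le> t - 1\<close>.\<close>
  have k_less: "k < t choose (r - 1)"
  proof -
    have "t choose (r - 1) = ((t - 1) choose (r - 2)) + ((t - 1) choose (r - 1))"
      using tr binomial_Suc_Suc[of "t - 1" "r - 2"] by (simp add: Suc_diff_Suc numeral_2_eq_2)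
    then show ?thesis using tr by (simp add: k)
  qed
  have e_ne: "e \<noteq> {}" using e_S e_AB by (cases "J = {}") auto
  have hyp: "hypergraph W"
    unfolding hypergraph_def
  proof (intro conjI ballI)
    show "finite (verts W)" by (rule finW)
    fix d assume "d \<in> edges W"
    then consider "d = e" | "d \<in> edges A \<union> edges B" | "d \<in> F"
      | j where "j \<in> J" "d \<in> edges (S j)" | j where "j \<in> J" "d \<in> G j"
      unfolding E by blast
    then have "d \<noteq> {} \<and> d \<subseteq> verts W"
    proof cases
      case 1 then show ?thesis using e e_ne by simp
    next
      case 2 then show ?thesis using A B tr by (auto simp: is_complete_def W)
    next
      case 3 then show ?thesis using F by (auto simp: crossing_sets_def W)
    next
      case (4 j) then show ?thesis using S[of j] tr by (auto simp: is_complete_def W)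
    next
      case (5 j) then show ?thesis using G[of j] by (auto simp: crossing_sets_def W)
    qed
    then show "d \<noteq> {}" "d \<subseteq> verts W" by auto
  qed
  have ES: "verts (S j) \<subseteq> verts W" "edges (S j) \<subseteq> edges W" if "j \<in> J" for j
    using that by (auto simp: W E)
  \<comment> \<open>A copy on exactly \<open>t\<close> vertices only guarantees \<open>k\<close>
    edges, one short of the goal.\<close>
  have split_S: "k \<le> card (cut_edges W X \<inter> edges (S j))"
    if "j \<in> J" "X \<inter> verts (S j) \<noteq> {}" "\<not> verts (S j) \<subseteq> X" for X j
    using complete_card_cut_edges_ge[OF hyp S ES that(2,3)] that(1) tr(2) k by simp
  \<comment> \<open>Here \<open>m - 1 \<ge> t\<close>, so the strict inequality
    \<open>k_less\<close> gives the missing edge at once.\<close>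
  have split_AB: "k + 1 \<le> cut_degree W X"
    if K: "is_complete r m K" "t < m" "verts K \<subseteq> verts W" "edges K \<subseteq> edges W"
      and X: "X \<inter> verts K \<noteq> {}" "\<not> verts K \<subseteq> X" for X m K
  proof -
    have "t choose (r - 1) \<le> (m - 1) choose (r - 1)" using K(2) by (intro binomial_right_mono) simp
    also have "\<dots> \<le> card (cut_edges W X \<inter> edges K)"
      using complete_card_cut_edges_ge[OF hyp K(1,3,4) X tr(2)] .
    also have "\<dots> \<le> cut_degree W X"
      unfolding cut_degree_eq_card_cut_edges
      by (intro card_mono finite_cut_edges hyp) auto
    finally show ?thesis using k_less by simp
  qed
  have G_inW: "g \<subseteq> verts W" "g \<in> edges W" if "j \<in> J" "g \<in> G j" for j g
  proof -
    show "g \<in> edges W" using that by (auto simp: E)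
    then show "g \<subseteq> verts W" using hyp by (auto simp: hypergraph_def)
  qed
  \<comment> \<open>This fact and the next ensure that an extra cut edge is really new: an attaching
    edge reaches \<open>A \<union> B\<close>, which no edge of a copy does, and an edge of
    \<open>G j\<close> avoids every other copy.\<close>
  have G_notin_S: "g \<notin> edges (S i)" if "i \<in> J" "j \<in> J" "g \<in> G j" for i j g
  proof -
    have "g \<inter> (verts A \<union> verts B) \<noteq> {}" using G[OF that(2)] that(3) by (auto simp: crossing_sets_def)
    then show ?thesis using S[OF that(1)] S_AB[OF that(1)] by (auto simp: is_complete_def)
  qed
  have G_notin_G: "g \<notin> G i" if "i \<in> J" "j \<in> J" "i \<noteq> j" "g \<in> G j" for i j g
  proof -
    have "g \<inter> verts (S j) \<noteq> {}" "g \<subseteq> verts (S j) \<union> (verts A \<union> verts B)"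
      using G[OF that(2)] that(4) by (auto simp: crossing_sets_def)
    moreover have "h \<inter> verts (S i) \<noteq> {}" if "h \<in> G i" for h
      using G[OF \<open>i \<in> J\<close>] that by (auto simp: crossing_sets_def)
    ultimately show ?thesis using S_disj[OF that(1-3)] S_AB[OF that(1)] by fast
  qed

  have same_side: "k + 1 \<le> cut_degree W X"
    if X: "X \<noteq> {}" "X \<subseteq> verts W" "X \<inter> (verts A \<union> verts B) = {}" for X
  proof -
    obtain j where j: "j \<in> J" "X \<inter> verts (S j) \<noteq> {}" using X unfolding W by blast
    then obtain v where v: "v \<in> X" "v \<in> verts (S j)" by blast
    \<comment> \<open>An attaching edge always has a vertex in \<open>A \<union> B\<close>, hence
      outside \<open>X\<close>, so meeting \<open>X\<close> is enough for it to be cut.\<close>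
    have G_cut: "g \<in> cut_edges W X" if "i \<in> J" "g \<in> G i" "g \<inter> X \<noteq> {}" for g i
    proof -
      have "g \<inter> (verts A \<union> verts B) \<noteq> {}" using G[OF that(1)] that(2) by (auto simp: crossing_sets_def)
      moreover have "verts A \<union> verts B \<subseteq> verts W - X" using X by (auto simp: W)
      ultimately show ?thesis using that G_inW[OF that(1,2)] by (auto simp: cut_edges_def)
    qed
    have split: "k + 1 \<le> cut_degree W X"
      if i: "i \<in> J" "X \<inter> verts (S i) \<noteq> {}" "\<not> verts (S i) \<subseteq> X" for i
    proof -
      obtain w where w: "w \<in> X" "w \<in> verts (S i)" using i by blast
      then obtain g where g: "g \<in> G i" "w \<in> g" using G_cover[OF i(1)] by blast
      show ?thesis
      proof (rule cut_degree_ge_Suc[OF hyp _ _ _ split_S[OF i]])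
        show "g \<in> cut_edges W X" using G_cut[OF i(1) g(1)] g w by blast
        show "g \<notin> cut_edges W X \<inter> edges (S i)" using G_notin_S[OF i(1) i(1) g(1)] by blast
      qed auto
    qed
    show ?thesis
    proof (cases "\<exists>i\<in>J. X \<inter> verts (S i) \<noteq> {} \<and> \<not> verts (S i) \<subseteq> X")
      case True then show ?thesis using split by blast
    next
      case False
      then have SX: "verts (S i) \<subseteq> X" if "i \<in> J" "X \<inter> verts (S i) \<noteq> {}" for i using that by blast
      have G_meets: "g \<inter> X \<noteq> {}" if "i \<in> J" "X \<inter> verts (S i) \<noteq> {}" "g \<in> G i" for i g
      proof -
        have "g \<inter> verts (S i) \<noteq> {}" using G[OF that(1)] that(3) by (auto simp: crossing_sets_def)
        then show ?thesis using SX[OF that(1,2)] by blast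
      qed
      have Gj: "G j \<subseteq> cut_edges W X" using G_cut G_meets j by blast
      show ?thesis
      proof (cases "X = verts (S j)")
        case True
        have "e \<in> cut_edges W X" using e e_S[OF j(1)] True by (auto simp: cut_edges_def E)
        then show ?thesis
          using cut_degree_ge_Suc[OF hyp Gj] e(3)[OF j(1)] G_card[OF j(1)] by simp
      next
        case False
        \<comment> \<open>Now \<open>X\<close> is a union of whole copies and contains a second one,
          \<open>S i\<close>; any attaching edge of \<open>S i\<close> is cut and lies outside
          \<open>G j\<close>.\<close>
        then obtain w where "w \<in> X" "w \<notin> verts (S j)" using SX[OF j] by blast
        then obtain i where i: "i \<in> J" "w \<in> verts (S i)" "i \<noteq> j" using X unfolding W by blast
        then obtain g where g: "g \<in> G i" "w \<in> g" using G_cover by blast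
        have "g \<in> cut_edges W X" using G_cut[OF i(1) g(1)] g \<open>w \<in> X\<close> by blast
        then show ?thesis
          using cut_degree_ge_Suc[OF hyp Gj] G_notin_G[OF j(1) i(1) _ g(1)] i G_card[OF j(1)] by simp
      qed
    qed
  qed

  have separated: "k + 1 \<le> cut_degree W X"
    if X: "X \<subseteq> verts W" "verts A \<subseteq> X" "verts B \<inter> X = {}" for X
  proof -
    have BW: "verts B \<subseteq> verts W - X" using X by (auto simp: W)
    have FX: "F \<subseteq> cut_edges W X"
    proof
      fix f assume f: "f \<in> F"
      then have "f \<inter> verts A \<noteq> {}" "f \<inter> verts B \<noteq> {}" using F by (auto simp: crossing_sets_def)
      moreover have "f \<in> edges W" using f by (simp add: E)
      ultimately show "f \<in> cut_edges W X" using X BW by (auto simp: cut_edges_def)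
    qed
    have suff: ?thesis if "d \<in> cut_edges W X" "d \<notin> F" for d
      using cut_degree_ge_Suc[OF hyp FX that] F by simp
    have F_AB: "f \<subseteq> verts A \<union> verts B" if "f \<in> F" for f
      using F that by (auto simp: crossing_sets_def)
    show ?thesis
    proof (cases "J = {}")
      case True
      then have "e \<in> cut_edges W X" using e_AB X BW by (auto simp: cut_edges_def E)
      then show ?thesis using suff e by blast
    next
      case False
      then obtain j where j: "j \<in> J" by blast
      \<comment> \<open>Edges of \<open>F\<close> stay inside \<open>A \<union> B\<close>, so any
        cut edge touching \<open>S j\<close> counts beyond the \<open>k\<close> edges of
        \<open>F\<close>.\<close>
      have not_F: "d \<notin> F" if "d \<inter> verts (S j) \<noteq> {}" for d
        using F_AB S_AB[OF j] that by blast
      have G_S: "g \<inter> verts (S j) \<noteq> {}" if "g \<in> G j" for g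
        using G[OF j] that by (auto simp: crossing_sets_def)
      \<comment> \<open>Wherever \<open>S j\<close> lies, a cut edge touches it: on the side of
        \<open>A\<close>, an attaching edge that meets \<open>B\<close>; on the side of
        \<open>B\<close>, one that meets \<open>A\<close>; if it is split, an edge of
        \<open>S j\<close>, because \<open>k > 0\<close>.\<close>
      consider "verts (S j) \<subseteq> X" | "X \<inter> verts (S j) = {}"
        | "X \<inter> verts (S j) \<noteq> {}" "\<not> verts (S j) \<subseteq> X" by blast
      then show ?thesis
      proof cases
        case 1
        obtain g where g: "g \<in> G j" "g \<inter> verts B \<noteq> {}" using G_B[OF j] by blast
        have "g \<in> cut_edges W X"
          using g G_S[OF g(1)] G_inW[OF j g(1)] 1 BW by (auto simp: cut_edges_def)
        then show ?thesis using suff not_F G_S[OF g(1)] by blast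
      next
        case 2
        obtain g where g: "g \<in> G j" "g \<inter> verts A \<noteq> {}" using G_A[OF j] by blast
        have "g \<in> cut_edges W X"
          using g G_S[OF g(1)] G_inW[OF j g(1)] 2 X ES[OF j] by (auto simp: cut_edges_def)
        then show ?thesis using suff not_F G_S[OF g(1)] by blast
      next
        case 3
        have "cut_edges W X \<inter> edges (S j) \<noteq> {}" using split_S[OF j 3] k_pos by auto
        then obtain d where d: "d \<in> cut_edges W X" "d \<in> edges (S j)" by blast
        have "d \<subseteq> verts (S j)" "d \<noteq> {}" using d(2) S[OF j] tr by (auto simp: is_complete_def)
        then have "d \<inter> verts (S j) \<noteq> {}" by blast
        then show ?thesis using suff d not_F by blast
      qed
    qed
  qed

  show ?thesis
  proof (rule edge_connectivity_ge[OF finW card_W])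
    fix X assume X: "X \<noteq> {}" "X \<subset> verts W"
    let ?X' = "verts W - X"
    have compl: "cut_degree W ?X' = cut_degree W X" using X by (intro cut_degree_complement) auto
    have AW: "verts A \<subseteq> verts W" "edges A \<subseteq> edges W" "verts B \<subseteq> verts W" "edges B \<subseteq> edges W"
      by (auto simp: W E)
    \<comment> \<open>Cases 4 and 6 are cases 3 and 5 for the complement of \<open>X\<close>, which
      has the same cut degree.\<close>
    consider "X \<inter> verts A \<noteq> {}" "\<not> verts A \<subseteq> X" | "X \<inter> verts B \<noteq> {}" "\<not> verts B \<subseteq> X"
      | "X \<inter> (verts A \<union> verts B) = {}" | "verts A \<union> verts B \<subseteq> X"
      | "verts A \<subseteq> X" "verts B \<inter> X = {}" | "verts B \<subseteq> X" "verts A \<inter> X = {}" by blast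
    then show "k + 1 \<le> cut_degree W X"
    proof cases
      case 1 then show ?thesis using split_AB[OF A ab(1) AW(1,2)] by blast
    next
      case 2 then show ?thesis using split_AB[OF B ab(2) AW(3,4)] by blast
    next
      case 3 then show ?thesis using same_side X by blast
    next
      case 4
      have "k + 1 \<le> cut_degree W ?X'" by (rule same_side) (use X 4 in auto)
      then show ?thesis by (simp only: compl)
    next
      case 5 then show ?thesis using separated X by blast
    next
      case 6
      have "k + 1 \<le> cut_degree W ?X'" by (rule separated) (use X 6 AW in auto)
      then show ?thesis by (simp only: compl)
    qed
  qed
qed

section \<open>Edge-maximality of the construction\<close>

theorem theorem4p4:
  fixes k t r n l p a b :: nat
    and A B H0 H :: "'a hypergraph"
    and F :: "'a set set"
    and S :: "nat \<Rightarrow> 'a hypergraph"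
    and G :: "nat \<Rightarrow> 'a set set"
  assumes "t > r" and "r > 2"
    and "k = (t - 1) choose (r - 1)"
    and "k * r \<ge> 2 * t"
    and "n = l + p * t"
    and "l \<ge> 2 * t + 2"
    and "int a = \<lceil>real l / 2\<rceil>" and "int b = \<lfloor>real l / 2\<rfloor>"
    and "is_complete r a A" and "is_complete r b B"
    and "verts A \<inter> verts B = {}"
    and "finite F" and "card F = k"
    and "F \<subseteq> crossing_sets r (verts A) (verts B)"
    and "H0 = Hypergraph (verts A \<union> verts B) (edges A \<union> edges B \<union> F)"
    and "\<forall>j\<in>{1..p}. is_complete r t (S j)"
    and "disjoint_family_on (\<lambda>j. verts (S j)) {1..p}"
    and "\<forall>j\<in>{1..p}. verts (S j) \<inter> verts H0 = {}"
    and "\<forall>j\<in>{1..p}. finite (G j) \<and> card (G j) = k"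
    and "\<forall>j\<in>{1..p}. G j \<subseteq> crossing_sets r (verts (S j)) (verts H0)"
    and "\<forall>j\<in>{1..p}. \<forall>v\<in>verts (S j). \<exists>e\<in>G j. v \<in> e"
    and "\<forall>j\<in>{1..p}. (\<exists>e\<in>G j. e \<inter> verts A \<noteq> {}) \<and> (\<exists>e\<in>G j. e \<inter> verts B \<noteq> {})"
    and "H = Hypergraph (verts H0 \<union> (\<Union>j\<in>{1..p}. verts (S j)))
                        (edges H0 \<union> (\<Union>j\<in>{1..p}. edges (S j) \<union> G j))"
  shows "edge_maximal r k l H"
proof -
  \<comment> \<open>From \<open>l \<ge> 2 * t + 2\<close> even the floor \<open>b\<close> is at
    least \<open>t + 1\<close>.\<close>
  have ab: "t < a" "t < b" "a + b = l" using assms(6-8) by linarith+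
  have VH0: "verts H0 = verts A \<union> verts B" and EH0: "edges H0 = edges A \<union> edges B \<union> F"
    using assms(15) by simp_all
  have VH: "verts H = verts H0 \<union> (\<Union>j\<in>{1..p}. verts (S j))"
    and EH: "edges H = edges H0 \<union> (\<Union>j\<in>{1..p}. edges (S j) \<union> G j)"
    using assms(23) by simp_all
  note A = assms(9) and B = assms(10) and AB = assms(11) and F = assms(14)
  have S: "is_complete r t (S j)" and S_H0: "verts (S j) \<inter> verts H0 = {}"
    and G: "G j \<subseteq> crossing_sets r (verts (S j)) (verts H0)"
    and G_card: "finite (G j)" "card (G j) = k" if "j \<in> {1..p}" for j
    using assms(16,18-20) that by blast+
  have S_disj: "verts (S i) \<inter> verts (S j) = {}" if "i \<in> {1..p}" "j \<in> {1..p}" "i \<noteq> j" for i j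
    using disjoint_family_onD[OF assms(17) that] .
  have finH0: "finite (verts H0)" and card_H0: "card (verts H0) = l"
    using A B AB ab by (auto simp: VH0 is_complete_def card_Un_disjoint)
  have finH: "finite (verts H)" using finH0 S by (auto simp: VH is_complete_def)
  have sub_H0: "d \<subseteq> verts H0" if "d \<in> edges H0" for d
    using that A B F by (auto simp: VH0 EH0 is_complete_def crossing_sets_def)

  have "uniform_hypergraph r H"
  proof -
    have "card d = r \<and> d \<noteq> {} \<and> d \<subseteq> verts H" if d: "d \<in> edges H" for d
    proof -
      consider "d \<in> edges A \<union> edges B" | "d \<in> F"
        | j where "j \<in> {1..p}" "d \<in> edges (S j)" | j where "j \<in> {1..p}" "d \<in> G j"
        using d unfolding EH EH0 by blast
      then have "card d = r \<and> d \<subseteq> verts H"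
      proof cases
        case 1 then show ?thesis using A B by (auto simp: is_complete_def VH VH0)
      next
        case 2 then show ?thesis using F by (auto simp: crossing_sets_def VH VH0)
      next
        case (3 j) then show ?thesis using S[of j] by (auto simp: is_complete_def VH)
      next
        case (4 j)
        then have "card d = r" "d \<subseteq> verts (S j) \<union> verts H0"
          using G[of j] by (auto simp: crossing_sets_def)
        then show ?thesis using 4(1) unfolding VH by blast
      qed
      then show ?thesis using assms(2) by auto
    qed
    then show ?thesis
      using finH by (auto simp: uniform_hypergraph_def hypergraph_def)
  qed

  moreover have "edge_connectivity H' \<le> k" if sub: "subhypergraph H' H" and l: "l \<le> card (verts H')" for H'
  proof -
    have V': "verts H' \<subseteq> verts H" and E': "edges H' \<subseteq> edges H"
      and sub': "\<And>d. d \<in> edges H' \<Longrightarrow> d \<subseteq> verts H'"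
      using sub by (auto simp: subhypergraph_def)
    have fin': "finite (verts H')" using V' finH by (rule finite_subset)
    \<comment> \<open>One proper cut whose edges all lie in a set of \<open>k\<close> edges
      suffices; that set will be \<open>G j\<close> or \<open>F\<close>.\<close>
    have bound: "edge_connectivity H' \<le> k"
      if "X \<noteq> {}" "X \<subset> verts H'" "cut_edges H' X \<subseteq> P" "finite P" "card P = k" for X P
    proof -
      have "card (cut_edges H' X) \<le> k" using card_mono that by metis
      then show ?thesis
        using edge_connectivity_le[OF fin' that(1,2)] by (simp add: cut_degree_eq_card_cut_edges)
    qed
    show ?thesis
    proof (cases "\<exists>j\<in>{1..p}. verts H' \<inter> verts (S j) \<noteq> {}")
      case True
      then obtain j where j: "j \<in> {1..p}" "verts H' \<inter> verts (S j) \<noteq> {}" by blast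
      show ?thesis
      proof (rule bound)
        show "verts H' \<inter> verts (S j) \<noteq> {}" by fact
        have "\<not> verts H' \<subseteq> verts (S j)"
        proof
          assume "verts H' \<subseteq> verts (S j)"
          then have "card (verts H') \<le> t" using S[OF j(1)] by (metis card_mono is_complete_def)
          then show False using l assms(6) by linarith
        qed
        then show "verts H' \<inter> verts (S j) \<subset> verts H'" by blast
        show "cut_edges H' (verts H' \<inter> verts (S j)) \<subseteq> G j"
        proof
          fix d assume "d \<in> cut_edges H' (verts H' \<inter> verts (S j))"
          then have d: "d \<in> edges H" "d \<inter> verts (S j) \<noteq> {}" "\<not> d \<subseteq> verts (S j)"
            using E' by (auto simp: cut_edges_def)
          consider "d \<in> edges H0" | i where "i \<in> {1..p}" "d \<in> edges (S i)"
            | i where "i \<in> {1..p}" "d \<in> G i" using d(1) unfolding EH by blast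
          then show "d \<in> G j"
          proof cases
            case 1 then show ?thesis using sub_H0 S_H0[OF j(1)] d by blast
          next
            case (2 i)
            then have "d \<subseteq> verts (S i)" using S[of i] by (auto simp: is_complete_def)
            then show ?thesis using S_disj[OF 2(1) j(1)] d by blast
          next
            case (3 i)
            then have "d \<subseteq> verts (S i) \<union> verts H0" using G[of i] by (auto simp: crossing_sets_def)
            then have "i = j" using S_disj[OF 3(1) j(1)] S_H0[OF j(1)] d by blast
            then show ?thesis using 3 by simp
          qed
        qed
      qed (use G_card[OF j(1)] in auto)
    next
      case False
      then have "verts H' \<subseteq> verts H0" using V' unfolding VH by blast
      \<comment> \<open>\<open>H0\<close> has exactly \<open>l\<close> vertices, so a part of it
        with at least \<open>l\<close> vertices is everything, and \<open>A\<close> against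
        \<open>B\<close> is a proper cut of \<open>H'\<close>.\<close>
      then have V'_eq: "verts H' = verts H0"
        using card_seteq[OF finH0] l card_H0 by simp
      show ?thesis
      proof (rule bound)
        show "verts A \<noteq> {}" using A ab by (auto simp: is_complete_def)
        have "verts B \<noteq> {}" using B ab by (auto simp: is_complete_def)
        then show "verts A \<subset> verts H'" using AB unfolding V'_eq VH0 by blast
        show "cut_edges H' (verts A) \<subseteq> F"
        proof
          fix d assume "d \<in> cut_edges H' (verts A)"
          then have d: "d \<in> edges H" "d \<subseteq> verts H0" "d \<inter> verts A \<noteq> {}" "\<not> d \<subseteq> verts A"
            using E' sub' V'_eq by (auto simp: cut_edges_def)
          have "d \<notin> edges (S i)" "d \<notin> G i" if i: "i \<in> {1..p}" for i
          proof -
            have "d \<inter> verts (S i) = {}" "d \<noteq> {}" using S_H0[OF i] d(2,3) by blast+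
            then show "d \<notin> edges (S i)" "d \<notin> G i"
              using S[OF i] G[OF i] by (auto simp: is_complete_def crossing_sets_def)
          qed
          then have "d \<in> edges A \<union> edges B \<union> F" using d(1) unfolding EH EH0 by blast
          then show "d \<in> F" using d A B AB by (auto simp: is_complete_def)
        qed
      qed (use assms(12,13) in auto)
    qed
  qed

  moreover have "\<exists>H''. subhypergraph H'' (add_edge H e) \<and> l \<le> card (verts H'') \<and>
      k + 1 \<le> edge_connectivity H''"
    if e: "e \<subseteq> verts H" "card e = r" "e \<notin> edges H" for e
  proof -
    \<comment> \<open>Copies that miss \<open>e\<close> must be left out: the \<open>k\<close> edges
      of \<open>G j\<close> would still be the only ones joining such an \<open>S j\<close> to the
      rest.\<close>
    define J where "J = {j \<in> {1..p}. e \<inter> verts (S j) \<noteq> {}}"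
    define W where "W = Hypergraph (verts A \<union> verts B \<union> (\<Union>j\<in>J. verts (S j)))
      (insert e (edges A \<union> edges B \<union> F \<union> (\<Union>j\<in>J. edges (S j) \<union> G j)))"
    have J: "j \<in> {1..p}" if "j \<in> J" for j using that by (simp add: J_def)
    have VW: "verts W = verts H0 \<union> (\<Union>j\<in>J. verts (S j))" by (simp add: W_def VH0)
    \<comment> \<open>A vertex of \<open>e\<close> outside \<open>H0\<close> lies in some copy, and
      that copy then belongs to \<open>J\<close>.\<close>
    have eW: "e \<subseteq> verts W" using e(1) unfolding VW VH J_def by blast
    have e_not: "e \<notin> edges A" "e \<notin> edges B" "e \<notin> F"
      using e(3) by (auto simp: EH EH0)
    have e_not_j: "e \<notin> edges (S j)" "e \<notin> G j" if "j \<in> J" for j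
      using e(3) J[OF that] by (auto simp: EH)
    have "k + 1 \<le> edge_connectivity W"
    proof (rule edge_connectivity_attached_ge[where A = A and B = B and S = S and G = G and J = J
          and F = F and e = e and r = r and t = t and a = a and b = b])
      \<comment> \<open>All \<open>r\<close>-subsets of a complete copy are edges, so the non-edge
        \<open>e\<close> cannot lie inside \<open>S j\<close>. The same argument for
        \<open>A\<close> and \<open>B\<close> settles the case of empty \<open>J\<close>.\<close>
      show "e \<inter> verts (S j) \<noteq> {} \<and> \<not> e \<subseteq> verts (S j)" if "j \<in> J" for j
        using e_not_j(1)[OF that] S[OF J[OF that]] that e(2) by (auto simp: J_def is_complete_def)
      show "e \<inter> verts A \<noteq> {} \<and> e \<inter> verts B \<noteq> {}" if "J = {}"
      proof -
        have "e \<subseteq> verts A \<union> verts B" using eW that by (simp add: VW VH0)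
        then show ?thesis using e_not e(2) A B by (auto simp: is_complete_def)
      qed
      show "finite J" by (simp add: J_def)
      show "verts W = verts A \<union> verts B \<union> (\<Union>j\<in>J. verts (S j))" by (simp add: W_def)
      show "edges W = insert e (edges A \<union> edges B \<union> F \<union> (\<Union>j\<in>J. edges (S j) \<union> G j))"
        by (simp add: W_def)
    qed (use assms(1-3,13) ab A B AB F S S_disj S_H0 G G_card assms(21,22) J eW e_not e_not_j
        in \<open>simp_all add: VH0\<close>)
    moreover have "l \<le> card (verts W)"
    proof -
      have "finite (verts W)" using finH0 S J by (auto simp: VW is_complete_def J_def)
      then have "card (verts H0) \<le> card (verts W)" by (intro card_mono) (auto simp: VW)
      then show ?thesis using card_H0 by simp
    qed
    moreover have "subhypergraph W (add_edge H e)"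
    proof -
      have "d \<subseteq> verts W" if d: "d \<in> edges W" for d
      proof -
        consider "d = e" | "d \<in> edges H0" | j where "j \<in> J" "d \<in> edges (S j)"
          | j where "j \<in> J" "d \<in> G j" using d by (auto simp: W_def EH0)
        then show ?thesis
        proof cases
          case 1 then show ?thesis using eW by simp
        next
          case 2 then show ?thesis using sub_H0 by (auto simp: VW)
        next
          case (3 j) then show ?thesis using S[OF J] by (auto simp: is_complete_def VW)
        next
          case (4 j)
          then have "d \<subseteq> verts (S j) \<union> verts H0" using G[OF J[OF 4(1)]] by (auto simp: crossing_sets_def)
          then show ?thesis using 4(1) unfolding VW by blast
        qed
      qed
      moreover have "verts W \<subseteq> verts H" using J by (auto simp: VW VH)
      moreover have "edges W \<subseteq> insert e (edges H)" using J by (auto simp: W_def EH EH0)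
      ultimately show ?thesis by (simp add: subhypergraph_def add_edge_def)
    qed
    ultimately show ?thesis by blast
  qed
  ultimately show ?thesis by (simp add: edge_maximal_def)
qed

end
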